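(* Let $n$ be a positive integer, let $D_{2n} = \langle r,s \mid r^n = s^2 = (sr)^2 = 1 \rangle$, and let $k$ be an integer with $1\le k\le \frac{n-1}{2}$ if $n$ is odd, or $1\le k\le\frac{n-2}{2}$ if $n$ is even. Let $\rho_k : D_{2n}\to GL_2(\mathbb{C})$ be the representation given by $$\rho_k(r) = \begin{bmatrix} \cos k\theta_n & -\sin k\theta_n \\ \sin k\theta_n & \cos k\theta_n \end{bmatrix},\qquad \rho_k(s) = \begin{bmatrix} 0 & 1 \\ 1 & 0 \end{bmatrix},\qquad \theta_n=\frac{2\pi}{n}.$$ Then $$\mathrm{HS}(\rho_k(D_{2n})) = \Pi_a \cup \Pi_2,\qquad\text{where } a = \frac{n}{\gcd(n,k)}.$$
   Context: For a set $S \subseteq M_m(\mathbb{C})$, $\mathrm{Co}(S)$ denotes the set of all (finite) convex combinations of elements of $S$, and the hull spectrum $\mathrm{HS}(S)\subseteq\mathbb{C}$ is the set of all complex numbers that occur as eigenvalues of some matrix in $\mathrm{Co}(S)$. $\rho_k(D_{2n})$ denotes the image of $\rho_k$. $\Pi_j$ denotes the convex hull in $\mathbb{C}$ of the $j$th roots of unity (so $\Pi_2=[-1,1]$). *)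

theory Defs
  imports "HOL-Analysis.Analysis" "HOL-Algebra.Group"
begin

text \<open>
  The letter (g, True) stands for the generator g and (g, False) for its inverse.
  Every element of the type of generators is a generator of the presented group, and
  its elements are the classes of words modulo the congruence generated by the relators.
\<close>

type_synonym 'g word = "('g \<times> bool) list"

inductive word_eq :: "'g word set \<Rightarrow> 'g word \<Rightarrow> 'g word \<Rightarrow> bool" for R :: "'g word set" where
  word_eq_refl: "word_eq R u u"
| word_eq_sym: "word_eq R u v \<Longrightarrow> word_eq R v u"
| word_eq_trans: "word_eq R u v \<Longrightarrow> word_eq R v w \<Longrightarrow> word_eq R u w"
| word_eq_append: "word_eq R u u' \<Longrightarrow> word_eq R v v' \<Longrightarrow> word_eq R (u @ v) (u' @ v')"
| word_eq_cancel: "word_eq R [(g, b), (g, \<not> b)] []"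
| word_eq_relator: "w \<in> R \<Longrightarrow> word_eq R w []"

definition word_class :: "'g word set \<Rightarrow> 'g word \<Rightarrow> 'g word set" where
  "word_class R u = {v. word_eq R u v}"

definition presented_group :: "'g word set \<Rightarrow> 'g word set monoid" where
  "presented_group R =
     \<lparr>carrier = range (word_class R),
      monoid.mult = (\<lambda>A B. {w. \<exists>u\<in>A. \<exists>v\<in>B. word_eq R (u @ v) w}),
      one = word_class R []\<rparr>"

lemma word_class_eq_iff: "word_class R u = word_class R v \<longleftrightarrow> word_eq R u v"
  unfolding word_class_def set_eq_iff mem_Collect_eq
  by (meson word_eq_refl word_eq_sym word_eq_trans)

lemma presented_group_mult:
  "word_class R u \<otimes>\<^bsub>presented_group R\<^esub> word_class R v = word_class R (u @ v)"
  unfolding presented_group_def word_class_def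
  by simp (meson word_eq_append word_eq_refl word_eq_sym word_eq_trans)

lemma word_eq_inverse: "\<exists>v. word_eq R (v @ u) []"
proof (induction u)
  case Nil
  show ?case by (rule exI[of _ "[]"]) (simp add: word_eq_refl)
next
  case (Cons x u)
  obtain g b where x: "x = (g, b)" by (cases x)
  obtain v where v: "word_eq R (v @ u) []" using Cons.IH by blast
  have "word_eq R [(g, \<not> b), (g, b)] []" using word_eq_cancel[of R g "\<not> b"] by simp
  from word_eq_append[OF word_eq_refl word_eq_append[OF this word_eq_refl]]
  have "word_eq R (v @ ([(g, \<not> b), (g, b)] @ u)) (v @ ([] @ u))" .
  then have "word_eq R ((v @ [(g, \<not> b)]) @ x # u) []"
    using v x word_eq_trans by fastforce
  then show ?case by blast
qed

lemma group_presented_group: "group (presented_group R)"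
proof (rule groupI)
  fix x assume "x \<in> carrier (presented_group R)"
  then obtain u where u: "x = word_class R u" by (auto simp: presented_group_def)
  obtain v where "word_eq R (v @ u) []" using word_eq_inverse by blast
  then have "word_class R v \<otimes>\<^bsub>presented_group R\<^esub> x = \<one>\<^bsub>presented_group R\<^esub>"
    unfolding u presented_group_mult by (simp add: presented_group_def word_class_eq_iff)
  then show "\<exists>y\<in>carrier (presented_group R). y \<otimes>\<^bsub>presented_group R\<^esub> x = \<one>\<^bsub>presented_group R\<^esub>"
    by (auto simp: presented_group_def)
next
  fix x assume "x \<in> carrier (presented_group R)"
  then obtain u where u: "x = word_class R u" by (auto simp: presented_group_def)
  have "\<one>\<^bsub>presented_group R\<^esub> = word_class R []" by (simp add: presented_group_def)
  then show "\<one>\<^bsub>presented_group R\<^esub> \<otimes>\<^bsub>presented_group R\<^esub> x = x"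
    by (simp add: u presented_group_mult)
next
  fix x y assume "x \<in> carrier (presented_group R)" "y \<in> carrier (presented_group R)"
  then obtain u v where "x = word_class R u" "y = word_class R v"
    by (auto simp: presented_group_def)
  then show "x \<otimes>\<^bsub>presented_group R\<^esub> y \<in> carrier (presented_group R)"
    by (simp add: presented_group_mult) (simp add: presented_group_def)
next
  fix x y z
  assume "x \<in> carrier (presented_group R)" "y \<in> carrier (presented_group R)"
    "z \<in> carrier (presented_group R)"
  then obtain u v w where "x = word_class R u" "y = word_class R v" "z = word_class R w"
    by (auto simp: presented_group_def)
  then show "x \<otimes>\<^bsub>presented_group R\<^esub> y \<otimes>\<^bsub>presented_group R\<^esub> z =
      x \<otimes>\<^bsub>presented_group R\<^esub> (y \<otimes>\<^bsub>presented_group R\<^esub> z)"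
    by (simp add: presented_group_mult)
qed (simp add: presented_group_def)

datatype dihedral_gen = Rot | Ref

definition dihedral_relators :: "nat \<Rightarrow> dihedral_gen word set" where
  "dihedral_relators n =
     {replicate n (Rot, True),
      [(Ref, True), (Ref, True)],
      [(Ref, True), (Rot, True), (Ref, True), (Rot, True)]}"

definition dihedral_group :: "nat \<Rightarrow> dihedral_gen word set monoid" where
  "dihedral_group n = presented_group (dihedral_relators n)"

definition dihedral_r :: "nat \<Rightarrow> dihedral_gen word set" where
  "dihedral_r n = word_class (dihedral_relators n) [(Rot, True)]"

definition dihedral_s :: "nat \<Rightarrow> dihedral_gen word set" where
  "dihedral_s n = word_class (dihedral_relators n) [(Ref, True)]"

definition general_linear :: "(complex ^ 'm ^ 'm) monoid" where
  "general_linear = \<lparr>carrier = {A. invertible A}, monoid.mult = (**), one = mat 1\<rparr>"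

definition eigenvalues :: "complex ^ 'm ^ 'm \<Rightarrow> complex set" where
  "eigenvalues A = {z. \<exists>v. v \<noteq> 0 \<and> A *v v = z *s v}"

definition hull_spectrum :: "(complex ^ 'm ^ 'm) set \<Rightarrow> complex set" where
  "hull_spectrum S = (\<Union>A\<in>convex hull S. eigenvalues A)"

definition root_polygon :: "nat \<Rightarrow> complex set" where
  "root_polygon j = convex hull {z. z ^ j = 1}"

definition plane_rotation :: "real \<Rightarrow> complex ^ 2 ^ 2" where
  "plane_rotation t =
     vector [vector [complex_of_real (cos t), - complex_of_real (sin t)],
             vector [complex_of_real (sin t), complex_of_real (cos t)]]"

definition swap_matrix :: "complex ^ 2 ^ 2" where
  "swap_matrix = vector [vector [0, 1], vector [1, 0]]"

fun word_eval :: "('g \<Rightarrow> complex ^ 'm ^ 'm) \<Rightarrow> ('g \<Rightarrow> complex ^ 'm ^ 'm) \<Rightarrow> 'g word \<Rightarrow> complex ^ 'm ^ 'm" where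
  "word_eval f f' [] = mat 1"
| "word_eval f f' ((g, b) # w) = (if b then f g else f' g) ** word_eval f f' w"

lemma word_eval_append: "word_eval f f' (u @ v) = word_eval f f' u ** word_eval f f' v"
  by (induction u) (auto simp: matrix_mul_assoc)

lemma word_eval_cong:
  assumes "word_eq R u v" "\<And>g. f g ** f' g = mat 1" "\<And>g. f' g ** f g = mat 1"
    "\<And>w. w \<in> R \<Longrightarrow> word_eval f f' w = mat 1"
  shows "word_eval f f' u = word_eval f f' v"
  using assms(1) by induction (auto simp: word_eval_append assms(2-4))

lemma invertible_word_eval:
  assumes "\<And>g. f g ** f' g = mat 1" "\<And>g. f' g ** f g = mat 1"
  shows "invertible (word_eval f f' w)"
proof (induction w)
  case Nil
  show ?case by (auto simp: invertible_def intro: exI[of _ "mat 1"])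
next
  case (Cons x w)
  have "invertible (f g)" "invertible (f' g)" for g
    using assms by (auto simp: invertible_def)
  then show ?case using Cons by (cases x) (auto intro: invertible_mult)
qed

lemma presented_group_hom_exists:
  fixes f f' :: "'g \<Rightarrow> complex ^ 'm ^ 'm"
  assumes "\<And>g. f g ** f' g = mat 1" "\<And>g. f' g ** f g = mat 1"
    "\<And>w. w \<in> R \<Longrightarrow> word_eval f f' w = mat 1"
  shows "\<exists>h\<in>hom (presented_group R) general_linear. \<forall>g. h (word_class R [(g, True)]) = f g"
proof -
  define h where "h = (\<lambda>A. word_eval f f' (SOME u. u \<in> A))"
  have h: "h (word_class R u) = word_eval f f' u" for u
  proof -
    have "u \<in> word_class R u" by (simp add: word_class_def word_eq_refl)
    then have "(SOME v. v \<in> word_class R u) \<in> word_class R u" by (rule someI)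
    then have "word_eq R u (SOME v. v \<in> word_class R u)" by (simp add: word_class_def)
    from word_eval_cong[OF this assms] show ?thesis by (simp add: h_def)
  qed
  have "h \<in> hom (presented_group R) general_linear"
  proof (rule homI)
    fix x assume "x \<in> carrier (presented_group R)"
    then show "h x \<in> carrier general_linear"
      using invertible_word_eval[of f f', OF assms(1,2)]
      by (auto simp: presented_group_def general_linear_def h)
  next
    fix x y assume "x \<in> carrier (presented_group R)" "y \<in> carrier (presented_group R)"
    then obtain u v where "x = word_class R u" "y = word_class R v"
      by (auto simp: presented_group_def)
    then show "h (x \<otimes>\<^bsub>presented_group R\<^esub> y) = h x \<otimes>\<^bsub>general_linear\<^esub> h y"
      by (simp add: presented_group_mult h word_eval_append general_linear_def)
  qed
  moreover have "h (word_class R [(g, True)]) = f g" for g by (simp add: h)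
  ultimately show ?thesis by blast
qed

lemma plane_rotation_mult: "plane_rotation s ** plane_rotation t = plane_rotation (s + t)"
  by (simp add: plane_rotation_def matrix_matrix_mult_def vec_eq_iff forall_2 sum_2 vector_2
      cos_add sin_add)

lemma plane_rotation_0: "plane_rotation 0 = mat 1"
  by (simp add: plane_rotation_def mat_def vec_eq_iff forall_2 vector_2)

lemma swap_matrix_swap: "swap_matrix ** swap_matrix = mat 1"
  by (simp add: swap_matrix_def mat_def matrix_matrix_mult_def vec_eq_iff forall_2 sum_2 vector_2)

lemma swap_rotation: "swap_matrix ** plane_rotation t ** swap_matrix = plane_rotation (- t)"
  by (simp add: swap_matrix_def plane_rotation_def matrix_matrix_mult_def vec_eq_iff forall_2
      sum_2 vector_2)

text \<open>
  A homomorphism prescribed on the two generators is unique on the carrier; the following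
  shows that it exists, so it may be introduced by its values on the generators.
\<close>

lemma dihedral_representation_exists:
  assumes "n > 0"
  shows "\<exists>\<rho>\<in>hom (dihedral_group n) general_linear.
           \<rho> (dihedral_r n) = plane_rotation (real k * (2 * pi / real n)) \<and>
           \<rho> (dihedral_s n) = swap_matrix"
proof -
  define t where "t = real k * (2 * pi / real n)"
  define f where "f g = (case g of Rot \<Rightarrow> plane_rotation t | Ref \<Rightarrow> swap_matrix)" for g
  define f' where "f' g = (case g of Rot \<Rightarrow> plane_rotation (- t) | Ref \<Rightarrow> swap_matrix)" for g
  have inv: "f g ** f' g = mat 1" "f' g ** f g = mat 1" for g
    by (cases g; simp add: f_def f'_def plane_rotation_mult plane_rotation_0 swap_matrix_swap)+
  have pow: "word_eval f f' (replicate m (Rot, True)) = plane_rotation (real m * t)" for m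
    by (induction m) (auto simp: plane_rotation_0 plane_rotation_mult f_def algebra_simps)
  have nt: "real n * t = 2 * pi * real k" using assms by (simp add: t_def)
  have "cos (2 * pi * real k) = 1" "sin (2 * pi * real k) = 0"
    by (simp_all add: cos_int_2pin[of "int k", simplified] sin_int_2pin[of "int k", simplified])
  then have "plane_rotation (real n * t) = plane_rotation 0"
    by (simp add: nt plane_rotation_def)
  moreover have "word_eval f f' [(Ref, True), (Rot, True), (Ref, True), (Rot, True)] = mat 1"
    by (simp add: f_def matrix_mul_assoc swap_rotation plane_rotation_mult plane_rotation_0)
  ultimately have "word_eval f f' w = mat 1" if "w \<in> dihedral_relators n" for w
    using that pow[of n]
    by (auto simp: dihedral_relators_def f_def swap_matrix_swap plane_rotation_0)
  from presented_group_hom_exists[of f f', OF inv this]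
  obtain h where "h \<in> hom (dihedral_group n) general_linear"
    "\<And>g. h (word_class (dihedral_relators n) [(g, True)]) = f g"
    by (auto simp: dihedral_group_def)
  then show ?thesis
    by (intro bexI[of _ h]) (auto simp: dihedral_r_def dihedral_s_def f_def t_def)
qed

end

theory Submission imports Defs begin

text \<open>
  Identify the real plane with the complex numbers, so that a real 2 by 2 matrix becomes a map
  \<open>z \<mapsto> \<alpha> z + \<beta> (cnj z)\<close>. The rotations in the image of the representation are the pairs
  \<open>(\<zeta>, 0)\<close> and the reflections the pairs \<open>(0, \<i> \<zeta>)\<close>, where \<open>\<zeta> ^ a = 1\<close>. All of them lie in the
  convex set given by \<open>\<alpha> \<in> \<Pi>\<^sub>a\<close> and \<open>\<bar>\<alpha>\<bar> + \<bar>\<beta>\<bar> \<le> 1\<close>. The eigenvalues are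
  \<open>Re \<alpha> \<plusminus> sqrt (\<bar>\<beta>\<bar>\<^sup>2 - (Im \<alpha>)\<^sup>2)\<close>: a non-real one lies on the segment from \<open>\<alpha>\<close> to
  \<open>cnj \<alpha>\<close>, hence in \<open>\<Pi>\<^sub>a\<close>, and a real one \<open>x\<close> satisfies \<open>\<bar>\<alpha> - x\<bar> = \<bar>\<beta>\<bar>\<close>, hence \<open>\<bar>x\<bar> \<le> 1\<close>.
  Conversely \<open>(\<alpha>, 0)\<close> has eigenvalue \<open>\<alpha>\<close>, and the segment from the identity to
  \<open>\<rho>(s)\<close> yields all of \<open>[-1, 1]\<close>.
\<close>

section \<open>Real-linear maps of the plane and their eigenvalues\<close>

definition real_linear_matrix :: "complex \<Rightarrow> complex \<Rightarrow> complex ^ 2 ^ 2" where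
  "real_linear_matrix \<alpha> \<beta> =
     vector [vector [of_real (Re \<alpha> + Re \<beta>), of_real (Im \<beta> - Im \<alpha>)],
             vector [of_real (Im \<alpha> + Im \<beta>), of_real (Re \<alpha> - Re \<beta>)]]"

text \<open>Substitute \<open>\<gamma> * z + \<delta> * cnj z\<close> into the first map: the terms
  that meet \<beta> are conjugated.\<close>

lemma real_linear_matrix_mult:
  "real_linear_matrix \<alpha> \<beta> ** real_linear_matrix \<gamma> \<delta> =
     real_linear_matrix (\<alpha> * \<gamma> + \<beta> * cnj \<delta>) (\<alpha> * \<delta> + \<beta> * cnj \<gamma>)"
  by (simp add: real_linear_matrix_def matrix_matrix_mult_def vec_eq_iff forall_2 sum_2)
    (intro conjI complex_eqI; simp add: algebra_simps)

lemma plane_rotation_eq: "plane_rotation t = real_linear_matrix (cis t) 0"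
  by (simp add: real_linear_matrix_def plane_rotation_def)

text \<open>Exchanging the coordinates of \<open>x + \<i> * y\<close> gives
  \<open>y + \<i> * x\<close>, which is \<i> times the conjugate.\<close>

lemma swap_matrix_eq: "swap_matrix = real_linear_matrix 0 \<i>"
  by (simp add: real_linear_matrix_def swap_matrix_def)

lemma mat_1_eq: "mat 1 = real_linear_matrix 1 0"
  by (simp add: real_linear_matrix_def mat_def vec_eq_iff forall_2 vector_2)

text \<open>Linearity over the reals moves convex sets and convex hulls from pairs to
  matrices.\<close>

lemma linear_real_linear_matrix: "linear (\<lambda>(\<alpha>, \<beta>). real_linear_matrix \<alpha> \<beta>)"
  by (rule linearI)
    (auto simp: real_linear_matrix_def vec_eq_iff forall_2 vector_2 algebra_simps
      scaleR_conv_of_real[where 'a = complex])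

lemma eigenvalues_iff_det:
  fixes A :: "complex ^ 'm ^ 'm"
  shows "z \<in> eigenvalues A \<longleftrightarrow> det (A - mat z) = 0"
proof -
  have "(A - mat z) *v v = A *v v - z *s v" for v
  proof -
    have "mat z *v v = z *s v"
      by (simp add: matrix_vector_mult_def mat_def vec_eq_iff if_distrib if_distribR cong: if_cong)
    then show ?thesis by (simp add: matrix_vector_mult_diff_rdistrib)
  qed
  moreover have "det (A - mat z) \<noteq> 0 \<longleftrightarrow> (\<forall>v. (A - mat z) *v v = 0 \<longrightarrow> v = 0)"
    by (metis invertible_det_nz invertible_left_inverse matrix_left_invertible_ker)
  ultimately show ?thesis
    by (auto simp: eigenvalues_def)
qed

text \<open>The trace is \<open>2 * Re \<alpha>\<close> and the determinant is
  \<open>(cmod \<alpha>)\<^sup>2 - (cmod \<beta>)\<^sup>2\<close>; completing the square in the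
  characteristic polynomial gives the equation.\<close>

lemma eigenvalues_real_linear_matrix:
  "z \<in> eigenvalues (real_linear_matrix \<alpha> \<beta>) \<longleftrightarrow>
     (z - of_real (Re \<alpha>))\<^sup>2 = of_real ((cmod \<beta>)\<^sup>2 - (Im \<alpha>)\<^sup>2)"
proof -
  have "det (real_linear_matrix \<alpha> \<beta> - mat z) =
      (z - of_real (Re \<alpha>))\<^sup>2 - of_real ((cmod \<beta>)\<^sup>2 - (Im \<alpha>)\<^sup>2)"
    unfolding cmod_power2
    by (simp add: det_2 real_linear_matrix_def mat_def algebra_simps power2_eq_square)
  then show ?thesis by (simp add: eigenvalues_iff_det)
qed

section \<open>Polygons spanned by roots of unity\<close>

lemma root_polygon_cnj:
  assumes "z \<in> root_polygon j"
  shows "cnj z \<in> root_polygon j"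
proof -
  have "cnj ` root_polygon j = convex hull (cnj ` {z. z ^ j = 1})"
    unfolding root_polygon_def
    by (rule convex_hull_linear_image) (simp add: bounded_linear.linear bounded_linear_cnj)
  also have "cnj ` {z. z ^ j = 1} = {z. z ^ j = 1}"
    by (auto simp: image_iff simp flip: complex_cnj_power intro!: exI[of _ "cnj _"])
  finally show ?thesis using assms by (auto simp: root_polygon_def)
qed

lemma root_polygon_between_conjugates:
  assumes "w \<in> root_polygon j" "Re z = Re w" "\<bar>Im z\<bar> \<le> \<bar>Im w\<bar>"
  shows "z \<in> root_polygon j"
proof (cases "Im w = 0")
  case True
  with assms have "z = w" by (simp add: complex_eq_iff)
  with assms show ?thesis by simp
next
  case False
  \<comment> \<open>The solution of \<open>u * Im w - (1 - u) * Im w = Im z\<close>, which places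
    \<open>z\<close> on the vertical segment from \<open>cnj w\<close> to \<open>w\<close>.\<close>
  define u where "u = (1 + Im z / Im w) / 2"
  have "\<bar>Im z / Im w\<bar> \<le> 1" using assms False by (simp add: divide_simps)
  then have "-1 \<le> Im z / Im w" "Im z / Im w \<le> 1" by linarith+
  then have u: "0 \<le> u" "0 \<le> 1 - u" by (simp_all add: u_def)
  have "u *\<^sub>R w + (1 - u) *\<^sub>R cnj w = z"
    using False assms by (simp add: complex_eq_iff u_def field_simps)
  moreover have "u *\<^sub>R w + (1 - u) *\<^sub>R cnj w \<in> root_polygon j"
    using u assms(1) root_polygon_cnj[OF assms(1)]
    by (intro convexD) (auto simp: root_polygon_def)
  ultimately show ?thesis by simp
qed

lemma root_polygon_2: "root_polygon 2 = of_real ` {-1..1}"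
proof -
  have "{z::complex. z ^ 2 = 1} = of_real ` {-1, 1}"
    by (auto simp: power2_eq_1_iff)
  then have "root_polygon 2 = of_real ` (convex hull {-1, 1})"
    unfolding root_polygon_def
    by (simp add: convex_hull_linear_image[OF bounded_linear.linear[OF bounded_linear_of_real]])
  then show ?thesis
    by (simp flip: segment_convex_hull add: closed_segment_eq_real_ivl)
qed

text \<open>The origin is the centroid of the roots, whose sum vanishes once there are at least two
  of them.\<close>

lemma zero_in_root_polygon:
  assumes "j > 1"
  shows "0 \<in> root_polygon j"
proof -
  let ?U = "{z::complex. z ^ j = 1}"
  have fin: "finite ?U" and card: "card ?U = j"
    using assms finite_roots_unity[of j] card_roots_unity_eq[of j] by auto
  have "(\<Sum>z\<in>?U. (1 / real j) *\<^sub>R z) \<in> convex hull ?U"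
    using fin card assms by (intro convex_sum) (auto simp: hull_inc)
  moreover have "(\<Sum>z\<in>?U. z) = 0"
    using sum_roots_unity[of j] assms by simp
  ultimately show ?thesis
    by (simp add: root_polygon_def flip: scaleR_right.sum)
qed

lemma norm_root_polygon_le:
  assumes "z \<in> root_polygon j" "j > 0"
  shows "cmod z \<le> 1"
proof -
  have "{z::complex. z ^ j = 1} \<subseteq> cball 0 1"
    using assms(2) power_eq_1_iff by fastforce
  then have "root_polygon j \<subseteq> cball 0 1"
    unfolding root_polygon_def by (rule hull_minimal) simp
  with assms(1) show ?thesis by auto
qed

section \<open>The image of the representation\<close>

context
  fixes n k :: nat and \<rho> :: "dihedral_gen word set \<Rightarrow> complex ^ 2 ^ 2"
  assumes n: "n > 0"
    and hom: "\<rho> \<in> hom (dihedral_group n) general_linear"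
    and rho_r: "\<rho> (dihedral_r n) = plane_rotation (real k * (2 * pi / real n))"
    and rho_s: "\<rho> (dihedral_s n) = swap_matrix"
begin

abbreviation dihedral_class :: "dihedral_gen word \<Rightarrow> dihedral_gen word set" where
  "dihedral_class \<equiv> word_class (dihedral_relators n)"

lemma rho_append: "\<rho> (dihedral_class (u @ v)) = \<rho> (dihedral_class u) ** \<rho> (dihedral_class v)"
proof -
  have "dihedral_class w \<in> carrier (dihedral_group n)" for w
    by (simp add: dihedral_group_def presented_group_def)
  from hom_mult[OF hom this[of u] this[of v]] show ?thesis
    by (simp add: dihedral_group_def presented_group_mult general_linear_def)
qed

lemma rho_Rot:
  "\<rho> (dihedral_class [(Rot, True)]) = real_linear_matrix (cis (real k * (2 * pi / real n))) 0"
  using rho_r by (simp add: dihedral_r_def plane_rotation_eq)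

lemma rho_Ref: "\<rho> (dihedral_class [(Ref, True)]) = real_linear_matrix 0 \<i>"
  using rho_s by (simp add: dihedral_s_def swap_matrix_eq)

text \<open>Membership in \<open>hom\<close> only gives compatibility with products, so the value at
  the identity is read off from the relator that squares the reflection.\<close>

lemma rho_Nil: "\<rho> (dihedral_class []) = mat 1"
proof -
  have "word_eq (dihedral_relators n) ([(Ref, True)] @ [(Ref, True)]) []"
    by (rule word_eq_relator) (simp add: dihedral_relators_def)
  then have "\<rho> (dihedral_class []) = \<rho> (dihedral_class ([(Ref, True)] @ [(Ref, True)]))"
    by (metis word_class_eq_iff)
  also have "\<dots> = mat 1"
    unfolding rho_append rho_Ref real_linear_matrix_mult by (simp add: mat_1_eq)
  finally show ?thesis .
qed

text \<open>The image of the inverse letter is a left inverse and \<open>B\<close> a right inverse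
  of the same matrix, so they agree.\<close>

lemma rho_inverse_letter:
  assumes "\<rho> (dihedral_class [(g, True)]) ** B = mat 1"
  shows "\<rho> (dihedral_class [(g, False)]) = B"
proof -
  have "word_eq (dihedral_relators n) ([(g, False)] @ [(g, True)]) []"
    using word_eq_cancel[of _ g False] by simp
  then have "\<rho> (dihedral_class [(g, False)]) ** \<rho> (dihedral_class [(g, True)]) = mat 1"
    by (metis word_class_eq_iff rho_append rho_Nil)
  with assms show ?thesis
    by (metis matrix_mul_assoc matrix_mul_lid matrix_mul_rid)
qed

lemma rho_Rot_inverse:
  "\<rho> (dihedral_class [(Rot, False)]) = real_linear_matrix (cis (- (real k * (2 * pi / real n)))) 0"
  by (rule rho_inverse_letter) (simp add: rho_Rot real_linear_matrix_mult mat_1_eq cis_mult)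

lemma rho_Ref_inverse: "\<rho> (dihedral_class [(Ref, False)]) = real_linear_matrix 0 \<i>"
  by (rule rho_inverse_letter) (simp add: rho_Ref real_linear_matrix_mult mat_1_eq)

lemma cis_power_order: "cis (real k * (2 * pi / real n)) ^ (n div gcd n k) = 1"
proof -
  have "(n div gcd n k) * k = n * (k div gcd n k)"
    by (metis div_mult_swap dvd_div_mult gcd_dvd1 gcd_dvd2)
  then have "real (n div gcd n k) * real k = real n * real (k div gcd n k)"
    by (metis of_nat_mult)
  then have angle:
    "real (n div gcd n k) * (real k * (2 * pi / real n)) = 2 * pi * real (k div gcd n k)"
    using n by (simp add: field_simps)
  show ?thesis
    unfolding Complex.DeMoivre angle by (rule cis_multiple_2pi) (rule Ints_of_nat)
qed

text \<open>Prefixing a rotation letter multiplies \<zeta> by a root of unity. Prefixing a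
  reflection letter conjugates \<zeta> and exchanges the two forms; the factor \<i> cancels because
  \<open>\<i> * cnj \<i> = 1\<close>.\<close>

lemma rho_word:
  "\<exists>\<zeta>. \<zeta> ^ (n div gcd n k) = 1 \<and>
     (\<rho> (dihedral_class w) = real_linear_matrix \<zeta> 0 \<or>
      \<rho> (dihedral_class w) = real_linear_matrix 0 (\<i> * \<zeta>))"
proof (induction w)
  case Nil
  show ?case by (rule exI[of _ 1]) (simp add: rho_Nil mat_1_eq)
next
  case (Cons x w)
  let ?a = "n div gcd n k" and ?t = "real k * (2 * pi / real n)"
  from Cons obtain \<zeta> where \<zeta>: "\<zeta> ^ ?a = 1"
    and w: "\<rho> (dihedral_class w) = real_linear_matrix \<zeta> 0 \<or>
      \<rho> (dihedral_class w) = real_linear_matrix 0 (\<i> * \<zeta>)" by blast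
  have split: "\<rho> (dihedral_class (x # w)) = \<rho> (dihedral_class [x]) ** \<rho> (dihedral_class w)"
    using rho_append[of "[x]" w] by simp
  have letter: "(\<exists>c. c ^ ?a = 1 \<and> \<rho> (dihedral_class [x]) = real_linear_matrix c 0) \<or>
      \<rho> (dihedral_class [x]) = real_linear_matrix 0 \<i>"
  proof -
    have "cis (- ?t) ^ ?a = 1"
      using arg_cong[OF cis_power_order, of cnj] by (simp add: cis_cnj)
    then show ?thesis
      using cis_power_order rho_Rot rho_Rot_inverse rho_Ref rho_Ref_inverse
      by (cases x; cases "fst x"; cases "snd x") auto
  qed
  have cnj: "cnj \<zeta> ^ ?a = 1"
    using arg_cong[OF \<zeta>, of cnj] by simp
  from letter show ?case
  proof (elim disjE exE conjE)
    fix c assume "c ^ ?a = 1" "\<rho> (dihedral_class [x]) = real_linear_matrix c 0"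
    then show ?thesis
      using w \<zeta> unfolding split
      by (intro exI[of _ "c * \<zeta>"])
        (auto simp: real_linear_matrix_mult power_mult_distrib algebra_simps)
  next
    assume "\<rho> (dihedral_class [x]) = real_linear_matrix 0 \<i>"
    then show ?thesis
      using w cnj unfolding split
      by (intro exI[of _ "cnj \<zeta>"]) (auto simp: real_linear_matrix_mult)
  qed
qed

lemma rho_image_subset:
  "\<rho> ` carrier (dihedral_group n) \<subseteq>
     (\<lambda>\<zeta>. real_linear_matrix \<zeta> 0) ` {\<zeta>. \<zeta> ^ (n div gcd n k) = 1} \<union>
     (\<lambda>\<zeta>. real_linear_matrix 0 (\<i> * \<zeta>)) ` {\<zeta>. \<zeta> ^ (n div gcd n k) = 1}"
  using rho_word by (fastforce simp: dihedral_group_def presented_group_def)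

lemma rho_Rot_power:
  "\<rho> (dihedral_class (replicate j (Rot, True))) =
     real_linear_matrix (cis (real j * (real k * (2 * pi / real n)))) 0"
proof (induction j)
  case 0
  show ?case by (simp add: rho_Nil mat_1_eq)
next
  case (Suc j)
  then show ?case
    using rho_append[of "[(Rot, True)]" "replicate j (Rot, True)"]
    by (simp add: rho_Rot real_linear_matrix_mult cis_mult add_divide_distrib algebra_simps)
qed

text \<open>By Bezout some power \<open>x\<close> of the rotation turns by
  \<open>2 * pi * gcd n k / n\<close> modulo full turns, the angle of a primitive root of order
  \<open>n div gcd n k\<close>; its powers give all the roots.\<close>

lemma rotation_in_image:
  assumes "k > 0" "\<zeta> ^ (n div gcd n k) = 1"
  shows "real_linear_matrix \<zeta> 0 \<in> \<rho> ` carrier (dihedral_group n)"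
proof -
  let ?g = "gcd n k"
  have "?g > 0" using n by simp
  have a: "n div ?g > 0" using n by (simp add: div_greater_zero_iff gcd_le1_nat)
  have ra: "real (n div ?g) = real n / real ?g" by (simp add: real_of_nat_div)
  obtain m where m: "\<zeta> = cis (2 * pi * real m / real (n div ?g))"
    using Complex.bij_betw_roots_unity[OF a] assms(2) by (auto simp: bij_betw_def image_iff set_eq_iff)
  obtain x y where "k * x = n * y + gcd k n"
    using bezout_nat[of k n] assms(1) by auto
  then have xy: "real k * real x = real n * real y + real ?g"
    by (metis gcd.commute of_nat_add of_nat_mult)
  have "real (m * x) * (real k * (2 * pi / real n)) =
      real m * (real k * real x) * (2 * pi / real n)" by simp
  also have "\<dots> = 2 * pi * real m / real (n div ?g) + 2 * pi * real (m * y)"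
    unfolding xy ra using n \<open>?g > 0\<close> by (simp add: field_simps)
  finally have "real (m * x) * (real k * (2 * pi / real n)) =
      2 * pi * real m / real (n div ?g) + 2 * pi * real (m * y)" .
  then have "cis (real (m * x) * (real k * (2 * pi / real n))) = \<zeta>"
    unfolding m by (simp only: flip: cis_mult) (simp add: cis_multiple_2pi del: of_nat_mult)
  then have "real_linear_matrix \<zeta> 0 = \<rho> (dihedral_class (replicate (m * x) (Rot, True)))"
    by (simp only: rho_Rot_power)
  then show ?thesis
    by (simp add: dihedral_group_def presented_group_def)
qed

lemma swap_in_image: "real_linear_matrix 0 \<i> \<in> \<rho> ` carrier (dihedral_group n)"
  unfolding rho_Ref[symmetric] by (simp add: dihedral_group_def presented_group_def)

section \<open>The hull spectrum lies in the two polygons\<close>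

lemma hull_image_subset:
  assumes "n div gcd n k > 1"
  shows "convex hull (\<rho> ` carrier (dihedral_group n)) \<subseteq>
    (\<lambda>(\<alpha>, \<beta>). real_linear_matrix \<alpha> \<beta>) `
      {(\<alpha>, \<beta>). \<alpha> \<in> root_polygon (n div gcd n k) \<and> cmod \<alpha> + cmod \<beta> \<le> 1}"
    (is "_ \<subseteq> ?M ` ?K")
proof (rule hull_minimal)
  let ?a = "n div gcd n k"
  have norm1: "cmod \<zeta> = 1" if "\<zeta> ^ ?a = 1" for \<zeta>
    using that assms power_eq_1_iff by fastforce
  have mem: "\<zeta> \<in> root_polygon ?a" if "\<zeta> ^ ?a = 1" for \<zeta>
    using that by (simp add: root_polygon_def hull_inc)
  \<comment> \<open>A reflection has \<alpha> = 0, so the origin must belong to the polygon; this is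
    where the order has to exceed 1.\<close>
  have in_K: "real_linear_matrix \<zeta> 0 \<in> ?M ` ?K" "real_linear_matrix 0 (\<i> * \<zeta>) \<in> ?M ` ?K"
    if "\<zeta> ^ ?a = 1" for \<zeta>
    using norm1[OF that] mem[OF that] zero_in_root_polygon[OF assms]
    by (auto simp: norm_mult intro: image_eqI[of _ _ "(\<zeta>, 0)"] image_eqI[of _ _ "(0, \<i> * \<zeta>)"])
  show "\<rho> ` carrier (dihedral_group n) \<subseteq> ?M ` ?K"
    by (intro subset_trans[OF rho_image_subset] Un_least image_subsetI)
      (simp_all only: mem_Collect_eq in_K)
  have "convex ?K"
  proof (rule convexI)
    fix p q :: "complex \<times> complex" and u v :: real
    assume p: "p \<in> ?K" and q: "q \<in> ?K" and uv: "0 \<le> u" "0 \<le> v" "u + v = 1"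
    obtain \<alpha> \<beta> \<gamma> \<delta> where pq: "p = (\<alpha>, \<beta>)" "q = (\<gamma>, \<delta>)" by fastforce
    have "u *\<^sub>R \<alpha> + v *\<^sub>R \<gamma> \<in> root_polygon ?a"
      using p q uv by (intro convexD) (auto simp: pq root_polygon_def)
    moreover have "cmod (u *\<^sub>R \<alpha> + v *\<^sub>R \<gamma>) + cmod (u *\<^sub>R \<beta> + v *\<^sub>R \<delta>) \<le> 1"
    proof -
      have "cmod (u *\<^sub>R \<alpha> + v *\<^sub>R \<gamma>) \<le> u * cmod \<alpha> + v * cmod \<gamma>"
        "cmod (u *\<^sub>R \<beta> + v *\<^sub>R \<delta>) \<le> u * cmod \<beta> + v * cmod \<delta>"
        using uv by (intro norm_triangle_le; simp)+
      moreover have "u * (cmod \<alpha> + cmod \<beta>) + v * (cmod \<gamma> + cmod \<delta>) \<le> 1"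
        using p q uv by (intro convex_bound_le) (auto simp: pq)
      ultimately show ?thesis by (simp add: algebra_simps)
    qed
    ultimately show "u *\<^sub>R p + v *\<^sub>R q \<in> ?K" by (simp add: pq)
  qed
  then show "convex (?M ` ?K)"
    by (rule convex_linear_image[OF linear_real_linear_matrix])
qed

lemma hull_spectrum_subset:
  assumes "n div gcd n k > 1"
  shows "hull_spectrum (\<rho> ` carrier (dihedral_group n)) \<subseteq>
    root_polygon (n div gcd n k) \<union> root_polygon 2"
proof
  let ?a = "n div gcd n k"
  fix z assume "z \<in> hull_spectrum (\<rho> ` carrier (dihedral_group n))"
  then obtain \<alpha> \<beta> where \<alpha>: "\<alpha> \<in> root_polygon ?a" and le: "cmod \<alpha> + cmod \<beta> \<le> 1"
    and z: "(z - of_real (Re \<alpha>))\<^sup>2 = of_real ((cmod \<beta>)\<^sup>2 - (Im \<alpha>)\<^sup>2)"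
    using hull_image_subset[OF assms] eigenvalues_real_linear_matrix
    by (fastforce simp: hull_spectrum_def)
  have re: "(Re z - Re \<alpha>)\<^sup>2 - (Im z)\<^sup>2 = (cmod \<beta>)\<^sup>2 - (Im \<alpha>)\<^sup>2"
    using arg_cong[OF z, of Re] by (simp add: Re_power2)
  \<comment> \<open>The square is real, so \<open>z\<close> is real or has the same real part as
    \<alpha>.\<close>
  have im: "(Re z - Re \<alpha>) * Im z = 0"
    using arg_cong[OF z, of Im] by (simp add: Im_power2)
  show "z \<in> root_polygon ?a \<union> root_polygon 2"
  proof (cases "Im z = 0")
    case True
    \<comment> \<open>For real \<open>z\<close> the eigenvalue equation says that \<open>z\<close>
      has distance \<open>cmod \<beta>\<close> from \<alpha>; the triangle inequality then bounds
      \<open>cmod z\<close>.\<close>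
    then have "(cmod (\<alpha> - z))\<^sup>2 = (cmod \<beta>)\<^sup>2"
      using re by (simp add: cmod_power2 power2_commute)
    then have "cmod (\<alpha> - z) = cmod \<beta>" by simp
    then have "cmod z \<le> 1"
      using le norm_triangle_sub[of z \<alpha>] by (simp add: norm_minus_commute)
    then have "\<bar>Re z\<bar> \<le> 1" using abs_Re_le_cmod order_trans by blast
    moreover have "z = of_real (Re z)" using True by (simp add: complex_eq_iff)
    ultimately show ?thesis
      unfolding root_polygon_2 by (metis UnI2 abs_le_iff atLeastAtMost_iff image_eqI minus_le_iff)
  next
    case False
    then have "Re z = Re \<alpha>" using im by simp
    moreover from this have "(Im z)\<^sup>2 = (Im \<alpha>)\<^sup>2 - (cmod \<beta>)\<^sup>2"
      using re by simp
    then have "\<bar>Im z\<bar> \<le> \<bar>Im \<alpha>\<bar>"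
      by (simp add: abs_le_square_iff)
    ultimately show ?thesis
      using root_polygon_between_conjugates[OF \<alpha>] by blast
  qed
qed

section \<open>Every point of the two polygons is attained\<close>

lemma root_polygons_subset_hull_spectrum:
  assumes "k > 0"
  shows "root_polygon (n div gcd n k) \<union> root_polygon 2 \<subseteq>
    hull_spectrum (\<rho> ` carrier (dihedral_group n))"
proof
  let ?a = "n div gcd n k" and ?S = "\<rho> ` carrier (dihedral_group n)"
  let ?M = "\<lambda>(\<alpha>, \<beta>). real_linear_matrix \<alpha> \<beta>"
  fix z assume "z \<in> root_polygon ?a \<union> root_polygon 2"
  then show "z \<in> hull_spectrum ?S"
  proof
    assume z: "z \<in> root_polygon ?a"
    have "linear (?M \<circ> (\<lambda>\<alpha>. (\<alpha>, 0)))"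
      by (intro linear_compose linear_real_linear_matrix linearI) auto
    then have "linear (\<lambda>\<alpha>. real_linear_matrix \<alpha> 0)" by (simp add: o_def)
    then have "(\<lambda>\<alpha>. real_linear_matrix \<alpha> 0) ` root_polygon ?a =
        convex hull ((\<lambda>\<alpha>. real_linear_matrix \<alpha> 0) ` {\<zeta>. \<zeta> ^ ?a = 1})"
      unfolding root_polygon_def by (rule convex_hull_linear_image)
    also have "\<dots> \<subseteq> convex hull ?S"
      using rotation_in_image[OF assms] by (intro hull_mono) auto
    finally have "real_linear_matrix z 0 \<in> convex hull ?S" using z by blast
    moreover have "z \<in> eigenvalues (real_linear_matrix z 0)"
      by (simp add: eigenvalues_real_linear_matrix complex_eq_iff Re_power2 Im_power2)
    ultimately show ?thesis by (auto simp: hull_spectrum_def)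
  next
    assume "z \<in> root_polygon 2"
    then obtain x where x: "z = of_real x" "-1 \<le> x" "x \<le> 1"
      by (auto simp: root_polygon_2)
    \<comment> \<open>The combination of the identity and the swap with weights \<open>p\<close> and
      \<open>1 - p\<close> has eigenvalues \<open>1\<close> and \<open>2 * p - 1\<close>; this
      choice makes the second one \<open>x\<close>.\<close>
    define p where "p = (1 + x) / 2"
    have p: "0 \<le> p" "0 \<le> 1 - p" "x - p = - (1 - p)"
      using x by (simp_all add: p_def field_simps)
    have "p *\<^sub>R ?M (1, 0) + (1 - p) *\<^sub>R ?M (0, \<i>) \<in> convex hull ?S"
      using p rotation_in_image[OF assms, of 1] swap_in_image
      by (intro convexD) (auto simp: hull_inc)
    also have "p *\<^sub>R ?M (1, 0) + (1 - p) *\<^sub>R ?M (0, \<i>) =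
        ?M (p *\<^sub>R (1, 0) + (1 - p) *\<^sub>R (0, \<i>))"
      by (simp only: linear_scale[OF linear_real_linear_matrix]
          linear_add[OF linear_real_linear_matrix])
    finally have "real_linear_matrix (of_real p) (of_real (1 - p) * \<i>) \<in> convex hull ?S"
      by (simp add: scaleR_conv_of_real)
    moreover have "z \<in> eigenvalues (real_linear_matrix (of_real p) (of_real (1 - p) * \<i>))"
    proof -
      have "(z - of_real p)\<^sup>2 = of_real ((x - p)\<^sup>2)" by (simp add: x)
      also have "\<dots> = of_real ((cmod (of_real (1 - p) * \<i>))\<^sup>2)"
        unfolding p(3) norm_mult norm_of_real
        by (simp only: power2_minus power2_abs norm_ii mult_1_right)
      finally show ?thesis by (simp add: eigenvalues_real_linear_matrix)
    qed
    ultimately show ?thesis by (auto simp: hull_spectrum_def)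
  qed
qed

end

theorem theorem5p3:
  fixes n k :: nat
    and \<rho> :: "dihedral_gen word set \<Rightarrow> complex ^ 2 ^ 2"
  assumes "n > 0"
    and "1 \<le> k"
    and "odd n \<Longrightarrow> real k \<le> (real n - 1) / 2"
    and "even n \<Longrightarrow> real k \<le> (real n - 2) / 2"
    and "\<rho> \<in> hom (dihedral_group n) general_linear"
    and "\<rho> (dihedral_r n) = plane_rotation (real k * (2 * pi / real n))"
    and "\<rho> (dihedral_s n) = swap_matrix"
  shows "hull_spectrum (\<rho> ` carrier (dihedral_group n)) =
           root_polygon (n div gcd n k) \<union> root_polygon 2"
proof (rule antisym)
  \<comment> \<open>The bounds on \<open>k\<close> enter only through \<open>k < n\<close>, which
    makes the gcd a proper divisor of \<open>n\<close>.\<close>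
  have "k < n" using assms(2-4) by (cases "even n") auto
  moreover have "gcd n k \<le> k" using assms(2) by (intro gcd_le2_nat) simp
  ultimately have "gcd n k < n" by simp
  \<comment> \<open>Quotient 0 would give \<open>n = 0\<close>, and quotient 1 would give
    \<open>n = gcd n k\<close>.\<close>
  moreover have "n = (n div gcd n k) * gcd n k" by simp
  ultimately have "n div gcd n k > 1"
    using assms(1) by (metis less_one linorder_neqE_nat mult_1 mult_zero_left nat_less_le)
  then show "hull_spectrum (\<rho> ` carrier (dihedral_group n)) \<subseteq>
      root_polygon (n div gcd n k) \<union> root_polygon 2"
    by (rule hull_spectrum_subset[OF assms(1,5-7)])
  show "root_polygon (n div gcd n k) \<union> root_polygon 2 \<subseteq>
      hull_spectrum (\<rho> ` carrier (dihedral_group n))"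
    using assms(2) by (intro root_polygons_subset_hull_spectrum[OF assms(1,5-7)]) simp
qed

end
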